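(* Let $\mathbf L=(L,\vee,\wedge,* )$ be a sectionally pseudocomplemented lattice with greatest element $1$ and let $\Theta\in\operatorname{Con}\mathbf L$. Then $[1]\Theta\in\operatorname{Fil}\mathbf L$, and for any $x,y\in L$, $$(x,y)\in\Theta\text{ if and only if }x*y,\,y*x\in[1]\Theta,$$ i.e. $\Phi([1]\Theta)=\Theta$.
   Context: A lattice $(L,\vee,\wedge)$ is sectionally pseudocomplemented if for all $a,b\in L$ there exists a greatest element $c$ of $L$ satisfying $(a\vee b)\wedge c=b$; this $c$ is denoted by $a*b$. Sectionally pseudocomplemented lattices are regarded as algebras $(L,\vee,\wedge,* )$ of type $(2,2,2)$. Only non-empty lattices are considered; then there is a greatest element $1$ (namely $x*x=1$ for every $x\in L$). $\operatorname{Con}\mathbf L$ is the set of congruences of the algebra $(L,\vee,\wedge,* )$, and $[1]\Theta$ is the $\Theta$-class of $1$. A filter of $\mathbf L$ is a subset $F$ of $L$ containing $1$ such that, for all $x,y,z\in L$, $x*y,y*x\in F$ implies $(x\vee z)*(y\vee z),\ (x\wedge z)*(y\wedge z),\ (x*z)*(y*z),\ (z*x)*(z*y)\in F$. $\operatorname{Fil}\mathbf L$ is the set of all filters of $\mathbf L$. For $M\subseteq L$ put $\Phi(M):=\{(x,y)\in L^2\mid x*y,\,y*x\in M\}$. *)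

theory Defs
  imports Main
begin

text \<open>
  The carrier is a type, hence non-empty.  The two axioms say that \<open>a \<star> b\<close> is the greatest
  element \<open>c\<close> with \<open>(a \<squnion> b) \<sqinter> c = b\<close>, so \<open>\<star>\<close> is determined by the lattice, and the class
  exists exactly on those lattices in which all these greatest elements exist.
\<close>

class sp_lattice = lattice +
  fixes spc :: "'a \<Rightarrow> 'a \<Rightarrow> 'a"  (infixl \<open>\<star>\<close> 80)
  assumes inf_sup_spc: "inf (sup a b) (a \<star> b) = b"
    and spc_greatest: "inf (sup a b) c = b \<Longrightarrow> c \<le> a \<star> b"

text \<open>Every such lattice has a greatest element, so naming it below restricts nothing.\<close>

lemma (in sp_lattice) le_spc_self: "y \<le> x \<star> x"
proof -
  have "inf (sup x x) (sup x y) = x"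
    by (simp add: inf_sup_absorb)
  then have "sup x y \<le> x \<star> x"
    by (rule spc_greatest)
  then show ?thesis
    by simp
qed

class sp_lattice_top = sp_lattice + bounded_lattice_top

lemma (in sp_lattice_top) spc_self: "x \<star> x = top"
  by (rule top_le, rule le_spc_self)

definition Con :: "('a::sp_lattice \<times> 'a) set set" where
  "Con = {\<Theta>. equiv UNIV \<Theta> \<and>
    (\<forall>x y u v. (x, y) \<in> \<Theta> \<longrightarrow> (u, v) \<in> \<Theta> \<longrightarrow>
      (sup x u, sup y v) \<in> \<Theta> \<and>
      (inf x u, inf y v) \<in> \<Theta> \<and>
      (x \<star> u, y \<star> v) \<in> \<Theta>)}"

text \<open>These filters differ from the order-theoretic filters of a lattice.\<close>

definition Fil :: "'a::sp_lattice_top set set" where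
  "Fil = {F. top \<in> F \<and>
    (\<forall>x y z. x \<star> y \<in> F \<longrightarrow> y \<star> x \<in> F \<longrightarrow>
      sup x z \<star> sup y z \<in> F \<and>
      inf x z \<star> inf y z \<in> F \<and>
      (x \<star> z) \<star> (y \<star> z) \<in> F \<and>
      (z \<star> x) \<star> (z \<star> y) \<in> F)}"

definition Phi :: "'a::sp_lattice set \<Rightarrow> ('a \<times> 'a) set" where
  "Phi M = {(x, y). x \<star> y \<in> M \<and> y \<star> x \<in> M}"

end

theory Submission imports Defs begin

text \<open>A congruence is determined by its class of \<open>top\<close>, because
  \<open>\<star>\<close> acts as an implication that can be undone by a lattice operation. If x and
  y are congruent, then \<open>x \<star> y\<close> is congruent to \<open>x \<star> x\<close>, which
  is \<open>top\<close>. Conversely, \<open>inf (sup x y) (x \<star> y) = y\<close> shows that once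
  \<open>x \<star> y\<close> collapses to \<open>top\<close>, \<open>sup x y\<close> collapses to y;
  by symmetry it also collapses to x. This equivalence, \<open>Con_iff_spc_top\<close>, is the
  description of \<Theta> through \<open>Phi\<close>, and it reduces the filter conditions to
  compatibility of \<Theta> with the operations.\<close>

lemma Con_compat:
  assumes "\<Theta> \<in> Con" "(x, y) \<in> \<Theta>" "(u, v) \<in> \<Theta>"
  shows "(sup x u, sup y v) \<in> \<Theta>" "(inf x u, inf y v) \<in> \<Theta>" "(x \<star> u, y \<star> v) \<in> \<Theta>"
  using assms unfolding Con_def by blast+

lemma Con_refl: "\<Theta> \<in> Con \<Longrightarrow> (x, x) \<in> \<Theta>"
  by (simp add: Con_def equiv_def refl_on_def)

lemma Con_sym: "\<Theta> \<in> Con \<Longrightarrow> (x, y) \<in> \<Theta> \<Longrightarrow> (y, x) \<in> \<Theta>"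
  by (auto simp: Con_def equiv_def dest: symD)

lemma Con_trans: "\<Theta> \<in> Con \<Longrightarrow> (x, y) \<in> \<Theta> \<Longrightarrow> (y, z) \<in> \<Theta> \<Longrightarrow> (x, z) \<in> \<Theta>"
  by (auto simp: Con_def equiv_def dest: transD)

lemma Con_spc_top:
  fixes \<Theta> :: "('a::sp_lattice_top \<times> 'a) set"
  assumes "\<Theta> \<in> Con" "(x, y) \<in> \<Theta>"
  shows "(top, x \<star> y) \<in> \<Theta>"
  using Con_compat(3)[OF assms(1) Con_refl[OF assms(1), of x] assms(2)] by (simp add: spc_self)

text \<open>Meet both sides of the hypothesis with \<open>sup x y\<close>: the side of
  \<open>top\<close> stays \<open>sup x y\<close>, and the other becomes y by the defining equation
  of \<open>\<star>\<close>.\<close>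

lemma Con_sup_of_spc_top:
  fixes \<Theta> :: "('a::sp_lattice_top \<times> 'a) set"
  assumes "\<Theta> \<in> Con" "(top, x \<star> y) \<in> \<Theta>"
  shows "(sup x y, y) \<in> \<Theta>"
  using Con_compat(2)[OF assms(1) Con_refl[OF assms(1), of "sup x y"] assms(2)]
  by (simp add: inf_sup_spc)

text \<open>For the converse direction, \<open>sup x y\<close> is the link: each of the two
  hypotheses identifies it with one of x and y.\<close>

lemma Con_iff_spc_top:
  fixes \<Theta> :: "('a::sp_lattice_top \<times> 'a) set"
  assumes \<Theta>: "\<Theta> \<in> Con"
  shows "(x, y) \<in> \<Theta> \<longleftrightarrow> (top, x \<star> y) \<in> \<Theta> \<and> (top, y \<star> x) \<in> \<Theta>"
proof
  assume "(x, y) \<in> \<Theta>"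
  then show "(top, x \<star> y) \<in> \<Theta> \<and> (top, y \<star> x) \<in> \<Theta>"
    using Con_spc_top[OF \<Theta>] Con_sym[OF \<Theta>] by blast
next
  assume "(top, x \<star> y) \<in> \<Theta> \<and> (top, y \<star> x) \<in> \<Theta>"
  then have "(sup x y, y) \<in> \<Theta>" "(sup x y, x) \<in> \<Theta>"
    using Con_sup_of_spc_top[OF \<Theta>, of x y] Con_sup_of_spc_top[OF \<Theta>, of y x]
    by (simp_all add: sup_commute)
  then show "(x, y) \<in> \<Theta>"
    using Con_sym[OF \<Theta>] Con_trans[OF \<Theta>] by blast
qed

lemma Con_top_class_Fil:
  fixes \<Theta> :: "('a::sp_lattice_top \<times> 'a) set"
  assumes \<Theta>: "\<Theta> \<in> Con"
  shows "\<Theta> `` {top} \<in> Fil"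
proof -
  have "(top, sup x z \<star> sup y z) \<in> \<Theta> \<and> (top, inf x z \<star> inf y z) \<in> \<Theta> \<and>
      (top, (x \<star> z) \<star> (y \<star> z)) \<in> \<Theta> \<and> (top, (z \<star> x) \<star> (z \<star> y)) \<in> \<Theta>"
    if "(top, x \<star> y) \<in> \<Theta>" "(top, y \<star> x) \<in> \<Theta>" for x y z
  proof -
    have xy: "(x, y) \<in> \<Theta>"
      using that Con_iff_spc_top[OF \<Theta>] by blast
    have zz: "(z, z) \<in> \<Theta>"
      by (rule Con_refl[OF \<Theta>])
    \<comment> \<open>Combining x and y with z by each operation gives congruent pairs, and for a
      congruent pair \<open>Con_spc_top\<close> puts its \<open>\<star>\<close> into the class of
      \<open>top\<close>. The second use of \<open>Con_compat\<close> covers z as the left argument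
      of \<open>\<star>\<close>, which is not commutative.\<close>
    show ?thesis
      using Con_compat[OF \<Theta> xy zz] Con_compat(3)[OF \<Theta> zz xy] Con_spc_top[OF \<Theta>] by blast
  qed
  then show ?thesis
    by (simp add: Fil_def Con_refl[OF \<Theta>])
qed

theorem theorem2p4:
  fixes \<Theta> :: "('a::sp_lattice_top \<times> 'a) set"
  assumes "\<Theta> \<in> Con"
  shows "\<Theta> `` {top} \<in> Fil
    \<and> (\<forall>x y. (x, y) \<in> \<Theta> \<longleftrightarrow> x \<star> y \<in> \<Theta> `` {top} \<and> y \<star> x \<in> \<Theta> `` {top})
    \<and> Phi (\<Theta> `` {top}) = \<Theta>"
proof -
  have iff: "(x, y) \<in> \<Theta> \<longleftrightarrow> x \<star> y \<in> \<Theta> `` {top} \<and> y \<star> x \<in> \<Theta> `` {top}" for x y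
    unfolding Image_singleton_iff by (rule Con_iff_spc_top[OF assms])
  then have "Phi (\<Theta> `` {top}) = \<Theta>"
    unfolding Phi_def by blast
  with iff Con_top_class_Fil[OF assms] show ?thesis
    by blast
qed

end
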